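(* For every $\varepsilon>0$ there exist $\delta>0$ and a constant $K>0$ such that for every constant $C>0$ there is a constant $c>0$ and infinitely many positive integers $n$ for which there exists an $n$-vertex directed unweighted graph $G=(V,E)$ with $|E|\le Kn$ such that for every shortcut set $H$ of $G$ with $|H|\le C n^{2-\varepsilon}$, the graph $G\cup H$ has diameter at least $c\, n^{\delta}$.
   Context: For a directed graph $G=(V,E)$, a shortcut set is a set $H$ of ordered pairs $(u,v)$ of distinct vertices such that $v$ is reachable from $u$ in $G$. $G\cup H$ denotes $(V,E\cup H)$. The diameter of a directed graph is $\max \mathrm{dist}(u,v)$ over all ordered pairs $(u,v)$ with $v$ reachable from $u$, with $\mathrm{dist}$ the unweighted shortest-path distance. *)

theory Defs
  imports "Graph_Theory.Graph_Theory"
begin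

text \<open>
  Unweighted distance: the library's shortest-path cost for the constant arc weight one.  It is
  \<^term>\<open>\<infinity> :: ereal\<close> exactly for unreachable pairs, which the diameter leaves out.
\<close>

definition unweighted_dist :: "('a, 'b) pre_digraph \<Rightarrow> 'a \<Rightarrow> 'a \<Rightarrow> ereal" where
  "unweighted_dist G u v = wf_digraph.\<mu> G (\<lambda>_. 1) u v"

definition digraph_diameter :: "('a, 'b) pre_digraph \<Rightarrow> ereal" where
  "digraph_diameter G = Max {unweighted_dist G u v |u v. u \<rightarrow>\<^sup>*\<^bsub>G\<^esub> v}"

text \<open>
  Reachability in the library is restricted to the vertices of the graph, so a shortcut set
  automatically consists of pairs of vertices.
\<close>

definition shortcut_set :: "'a pair_pre_digraph \<Rightarrow> 'a rel \<Rightarrow> bool" where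
  "shortcut_set G H \<longleftrightarrow> (\<forall>(u, v) \<in> H. u \<noteq> v \<and> u \<rightarrow>\<^sup>*\<^bsub>with_proj G\<^esub> v)"

definition add_shortcuts :: "'a pair_pre_digraph \<Rightarrow> 'a rel \<Rightarrow> 'a pair_pre_digraph" where
  "add_shortcuts G H = \<lparr>pverts = pverts G, parcs = parcs G \<union> H\<rparr>"

lemma shortcut_set_subset:
  assumes "shortcut_set G H"
  shows "H \<subseteq> pverts G \<times> pverts G"
  using assms unfolding shortcut_set_def by (auto elim!: reachable_in_vertsE)

lemma pair_digraph_add_shortcuts:
  assumes "pair_digraph G" and "shortcut_set G H"
  shows "pair_digraph (add_shortcuts G H)"
proof -
  interpret pair_digraph G by fact
  have "finite H"
    using shortcut_set_subset[OF assms(2)] pair_finite_verts by (meson finite_SigmaI finite_subset)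
  moreover have "fst e \<noteq> snd e" if "e \<in> H" for e
    using assms(2) that unfolding shortcut_set_def by auto
  ultimately show ?thesis
    using shortcut_set_subset[OF assms(2)] in_arcsD1 in_arcsD2
      pair_finite_verts pair_finite_arcs pair_no_loops
    by unfold_locales (auto simp: add_shortcuts_def)
qed

lemma (in wf_digraph) unweighted_dist_eq_INF_length:
  "unweighted_dist G u v = (INF p\<in>{p. awalk u p v}. ereal (real (length p)))"
  by (simp add: unweighted_dist_def \<mu>_def awalk_cost_def sum_list_triv)

text \<open>The maximum in the diameter ranges over a finite set, nonempty for nonempty graphs.\<close>

lemma (in fin_digraph) finite_unweighted_dists:
  "finite {unweighted_dist G u v |u v. u \<rightarrow>\<^sup>* v}"
proof (rule finite_subset)
  show "{unweighted_dist G u v |u v. u \<rightarrow>\<^sup>* v}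
      \<subseteq> (\<lambda>(u, v). unweighted_dist G u v) ` (verts G \<times> verts G)"
    using reachable_in_verts by fastforce
qed simp

lemma (in wf_digraph) unweighted_dists_nonempty:
  "verts G \<noteq> {} \<Longrightarrow> {unweighted_dist G u v |u v. u \<rightarrow>\<^sup>* v} \<noteq> {}"
  by auto

end

theory Submission
  imports Defs "HOL-Library.FuncSet"
begin

text \<open>
  Take a layered graph with layers \<open>0, \<dots>, k D\<close>, whose vertices carry \<open>k\<close> integer
  coordinates; an arc out of layer \<open>t\<close> adds an element of a fixed set \<open>V\<close> to coordinate
  \<open>t mod k\<close>. If a sum of \<open>D\<close> elements of \<open>V\<close> equals \<open>D v\<close> with
  \<open>v \<in> V\<close> only when all of them are \<open>v\<close>, then the path that always adds \<open>v j\<close> to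
  coordinate \<open>j\<close> is the only path between its endpoints. A shortcut that spans at least
  \<open>k\<close> layers changes every coordinate, so it determines \<open>v\<close> and the starting point and lies on
  at most one of these critical paths. Hence, if there are fewer shortcuts than critical paths, some
  critical path meets only shortcuts that span less than \<open>k\<close> layers, and its endpoints stay at
  distance at least \<open>D\<close>. Behrend's construction gives a set \<open>V\<close> so dense that, for
  large \<open>k\<close>, there are \<open>n ^ (2 - o(1))\<close> critical paths, even after isolated
  vertices are added to make the number of arcs at most \<open>n\<close>.
\<close>

section \<open>Average-free sets and Behrend's construction\<close>

text \<open>For \<open>D = 2\<close> this is the absence of nontrivial three-term progressions. The
  summands are indexed by naturals because they will be the elements of \<open>V\<close> added at
  certain layers.\<close>

definition average_free :: "nat \<Rightarrow> nat set \<Rightarrow> bool" where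
  "average_free D V \<longleftrightarrow> (\<forall>I :: nat set. \<forall>w v. finite I \<longrightarrow> card I = D \<longrightarrow> w ` I \<subseteq> V \<longrightarrow> v \<in> V \<longrightarrow>
     sum w I = D * v \<longrightarrow> (\<forall>i\<in>I. w i = v))"

lemma digits_unique:
  fixes a c :: "nat \<Rightarrow> nat"
  assumes "\<And>i. i < d \<Longrightarrow> a i < b" "\<And>i. i < d \<Longrightarrow> c i < b"
    and "(\<Sum>i<d. a i * b ^ i) = (\<Sum>i<d. c i * b ^ i)" and "i < d"
  shows "a i = c i"
  using assms
proof (induction d arbitrary: a c i)
  case (Suc d)
  have split: "(\<Sum>i<Suc d. f i * b ^ i) = f 0 + b * (\<Sum>i<d. f (Suc i) * b ^ i)" for f :: "nat \<Rightarrow> nat"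
    unfolding sum.lessThan_Suc_shift by (simp add: sum_distrib_left algebra_simps)
  have b: "b > 0" "a 0 < b" "c 0 < b"
    using Suc.prems(1,2)[of 0] by auto
  have eq: "a 0 + b * (\<Sum>i<d. a (Suc i) * b ^ i) = c 0 + b * (\<Sum>i<d. c (Suc i) * b ^ i)"
    using Suc.prems(3) unfolding split .
  have 0: "a 0 = c 0"
    using arg_cong[OF eq, of "\<lambda>x. x mod b"] b by simp
  with eq b have "(\<Sum>i<d. a (Suc i) * b ^ i) = (\<Sum>i<d. c (Suc i) * b ^ i)"
    by simp
  then have "a (Suc i) = c (Suc i)" if "i < d" for i
    using Suc.IH[of "\<lambda>i. a (Suc i)" "\<lambda>i. c (Suc i)" i] Suc.prems(1,2) that by auto
  with 0 Suc.prems(4) show ?case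
    by (cases i) auto
qed simp

lemma digits_bound:
  fixes a :: "nat \<Rightarrow> nat"
  assumes "\<And>i. i < d \<Longrightarrow> a i < b"
  shows "(\<Sum>i<d. a i * b ^ i) < b ^ d"
  using assms
proof (induction d)
  case (Suc d)
  have "(\<Sum>i<Suc d. a i * b ^ i) < b ^ d + a d * b ^ d"
    using Suc by simp
  also have "\<dots> = Suc (a d) * b ^ d" by simp
  also have "\<dots> \<le> b ^ Suc d"
    using Suc.prems[of d] by (metis Suc_leI lessI mult_le_mono1 power_Suc)
  finally show ?case .
qed simp

text \<open>Points on a sphere are extreme: if \<open>\<bar>w t\<bar> = \<bar>v\<bar>\<close> and the mean of the
  \<open>w t\<close> is \<open>v\<close>, then \<open>\<Sum>t. \<bar>w t - v\<bar>\<^sup>2 = 0\<close>.\<close>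

lemma sphere_average:
  fixes w :: "nat \<Rightarrow> nat \<Rightarrow> nat" and v :: "nat \<Rightarrow> nat"
  assumes "finite I"
    and norm: "\<And>t. t \<in> I \<Longrightarrow> (\<Sum>i<d. (w t i)\<^sup>2) = (\<Sum>i<d. (v i)\<^sup>2)"
    and mean: "\<And>i. i < d \<Longrightarrow> (\<Sum>t\<in>I. w t i) = card I * v i"
    and "t \<in> I" "i < d"
  shows "w t i = v i"
proof -
  define S where "S = (\<Sum>i<d. (int (v i))\<^sup>2)"
  have norm': "(\<Sum>i<d. (int (w t i))\<^sup>2) = S" if "t \<in> I" for t
    using arg_cong[OF norm[OF that], of int] by (simp add: S_def)
  have mean': "(\<Sum>t\<in>I. int (w t i)) = int (card I) * int (v i)" if "i < d" for i
    using arg_cong[OF mean[OF that], of int] by simp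
  have "(\<Sum>t\<in>I. \<Sum>i<d. (int (w t i) - int (v i))\<^sup>2)
      = (\<Sum>t\<in>I. (\<Sum>i<d. (int (w t i))\<^sup>2) + S - 2 * (\<Sum>i<d. int (w t i) * int (v i)))"
    by (simp add: power2_diff S_def sum.distrib sum_subtractf sum_distrib_left mult.assoc)
  also have "\<dots> = (\<Sum>t\<in>I. 2 * S) - 2 * (\<Sum>t\<in>I. \<Sum>i<d. int (w t i) * int (v i))"
    by (simp add: norm' sum_subtractf sum_distrib_left)
  \<comment> \<open>After swapping the sums, the mean condition applies to each coordinate and turns
    the cross term into a multiple of \<open>S\<close> that cancels the norms.\<close>
  also have "(\<Sum>t\<in>I. \<Sum>i<d. int (w t i) * int (v i)) = (\<Sum>i<d. (\<Sum>t\<in>I. int (w t i)) * int (v i))"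
    by (subst sum.swap) (simp add: sum_distrib_right)
  also have "\<dots> = card I * S"
    by (simp add: mean' S_def sum_distrib_left power2_eq_square mult.assoc)
  finally have "(\<Sum>t\<in>I. \<Sum>i<d. (int (w t i) - int (v i))\<^sup>2) = 0"
    by simp
  then have "(\<Sum>i<d. (int (w t i) - int (v i))\<^sup>2) = 0"
    using assms(1,4) by (subst (asm) sum_nonneg_eq_0_iff) (auto intro: sum_nonneg)
  then show ?thesis
    using assms(5) by (subst (asm) sum_nonneg_eq_0_iff) auto
qed

text \<open>Behrend's set: the integer points of a sphere, read as digits in base \<open>D * m\<close>,
  in which a sum of \<open>D\<close> vectors with entries below \<open>m\<close> produces no carry.\<close>

lemma average_free_set:
  fixes d m D :: nat
  assumes "d > 0" "m > 0" "D > 0"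
  obtains V where "V \<subseteq> {..<(D * m) ^ d}" "average_free D V" "m ^ d \<le> card V * (d * m\<^sup>2)"
proof -
  define F where "F = {..<d} \<rightarrow>\<^sub>E {..<m}"
  define norm where "norm f = (\<Sum>i<d. (f i)\<^sup>2)" for f :: "nat \<Rightarrow> nat"
  define code where "code f = (\<Sum>i<d. f i * (D * m) ^ i)" for f :: "nat \<Rightarrow> nat"
  have F_less: "f i < m" if "f \<in> F" "i < d" for f i
    using that by (auto simp: F_def)
  have fin: "finite F"
    by (simp add: F_def finite_PiE)
  have "norm \<in> F \<rightarrow> {..<d * m\<^sup>2}"
  proof
    fix f assume "f \<in> F"
    then have "norm f < (\<Sum>i<d. m\<^sup>2)"
      unfolding norm_def using assms F_less by (intro sum_strict_mono) (auto simp: power_strict_mono)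
    then show "norm f \<in> {..<d * m\<^sup>2}" by simp
  qed
  \<comment> \<open>The \<open>m ^ d\<close> points have at most \<open>d * m\<^sup>2\<close>
    different norms, so some sphere receives at least the average share.\<close>
  then obtain s where "card (norm -` {s} \<inter> F) * card {..<d * m\<^sup>2} \<ge> card F"
    using pigeonhole_card[of norm F "{..<d * m\<^sup>2}"] fin assms by (auto simp: lessThan_empty_iff)
  moreover define S where "S = norm -` {s} \<inter> F"
  ultimately have card: "m ^ d \<le> card S * (d * m\<^sup>2)"
    by (simp add: F_def card_funcsetE)
  have F_less': "f i < D * m" if "f \<in> F" "i < d" for f i
    using F_less[OF that] assms(3) by (cases D) auto
  have inj: "inj_on code F"
  proof (rule inj_onI)
    fix f g assume fg: "f \<in> F" "g \<in> F" "code f = code g"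
    have "f i = g i" if "i < d" for i
      using digits_unique[of d f "D * m" g i] fg that F_less'
      by (simp add: code_def)
    with fg show "f = g"
      unfolding F_def by (intro PiE_ext) auto
  qed
  have SF: "S \<subseteq> F" by (auto simp: S_def)
  show ?thesis
  proof
    show "code ` S \<subseteq> {..<(D * m) ^ d}"
      unfolding code_def using SF F_less' by (auto intro!: digits_bound)
    show "m ^ d \<le> card (code ` S) * (d * m\<^sup>2)"
      using card card_image[OF inj_on_subset[OF inj SF]] by simp
    show "average_free D (code ` S)"
      unfolding average_free_def
    proof (intro allI impI ballI)
      fix I :: "nat set" and w v t
      assume I: "finite I" "card I = D" and w: "w ` I \<subseteq> code ` S" and v: "v \<in> code ` S"
        and eq: "sum w I = D * v" and t: "t \<in> I"
      obtain g where g: "g \<in> S" "v = code g"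
        using v by auto
      have "\<forall>t\<in>I. \<exists>f. f \<in> S \<and> w t = code f"
        using w by auto
      then obtain f where f: "\<And>t. t \<in> I \<Longrightarrow> f t \<in> S" "\<And>t. t \<in> I \<Longrightarrow> w t = code (f t)"
        by metis
      \<comment> \<open>All digits on both sides stay below the base \<open>D * m\<close>, so the
        equation between codes is an equation between vectors.\<close>
      have sums: "(\<Sum>t\<in>I. f t i) = D * g i" if "i < d" for i
      proof (rule digits_unique[of d "\<lambda>i. \<Sum>t\<in>I. f t i" "D * m" "\<lambda>i. D * g i"])
        show "(\<Sum>t\<in>I. f t i) < D * m" if "i < d" for i
        proof -
          have "(\<Sum>t\<in>I. f t i) < (\<Sum>t\<in>I. m)"
            using f(1) SF F_less that t I by (intro sum_strict_mono) auto
          with I show ?thesis by simp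
        qed
        show "D * g i < D * m" if "i < d" for i
          using F_less[of g i] g SF that assms by auto
        have "(\<Sum>i<d. (\<Sum>t\<in>I. f t i) * (D * m) ^ i) = sum w I"
          by (simp add: f(2) code_def sum_distrib_right) (rule sum.swap)
        then show "(\<Sum>i<d. (\<Sum>t\<in>I. f t i) * (D * m) ^ i) = (\<Sum>i<d. D * g i * (D * m) ^ i)"
          using eq g(2) by (simp add: code_def sum_distrib_left mult.assoc)
      qed (use that in auto)
      have "f t i = g i" if "i < d" for i
      proof (rule sphere_average[where I = I and d = d and w = f and v = g])
        show "(\<Sum>i<d. (f t i)\<^sup>2) = (\<Sum>i<d. (g i)\<^sup>2)" if "t \<in> I" for t
          using f(1)[OF that] g(1) by (simp add: S_def norm_def)
      qed (use I sums t that in auto)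
      then show "w t = v"
        using f(2)[OF t] g(2) by (simp add: code_def)
    qed
  qed
qed

section \<open>Counting the updates of one coordinate\<close>

text \<open>These are the layers at which a walk from layer \<open>s\<close> to layer
  \<open>t\<close> updates coordinate \<open>j\<close>; the arc leaving layer \<open>t\<close> is
  not part of the walk, hence the half-open interval.\<close>

definition residue_times :: "nat \<Rightarrow> nat \<Rightarrow> nat \<Rightarrow> nat \<Rightarrow> nat set" where
  "residue_times k s t j = {i \<in> {s..<t}. i mod k = j}"

lemma finite_residue_times [simp]: "finite (residue_times k s t j)"
  by (simp add: residue_times_def)

lemma residue_times_append:
  assumes "s \<le> t" "t \<le> u"
  shows "residue_times k s u j = residue_times k s t j \<union> residue_times k t u j"
    and "residue_times k s t j \<inter> residue_times k t u j = {}"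
  using assms by (auto simp: residue_times_def)

lemma sum_residue_times_append:
  assumes "s \<le> t" "t \<le> u"
  shows "sum w (residue_times k s u j) = sum w (residue_times k s t j) + sum w (residue_times k t u j)"
  using sum.union_disjoint[of "residue_times k s t j" "residue_times k t u j" w]
    residue_times_append[OF assms] by simp

lemma card_residue_times_append:
  assumes "s \<le> t" "t \<le> u"
  shows "card (residue_times k s u j) = card (residue_times k s t j) + card (residue_times k t u j)"
  using card_Un_disjoint[of "residue_times k s t j" "residue_times k t u j"]
    residue_times_append[OF assms] by simp

lemma residue_times_same [simp]: "residue_times k t t j = {}"
  by (simp add: residue_times_def)

lemma residue_times_Suc [simp]: "residue_times k t (Suc t) j = (if t mod k = j then {t} else {})"
  by (auto simp: residue_times_def)

lemma residue_times_period:
  assumes "j < k"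
  shows "residue_times k (k * q) (k * Suc q) j = {k * q + j}"
proof -
  have "i = k * q + j" if "k * q \<le> i" "i < k * Suc q" "i mod k = j" for i
  proof -
    have "i div k = q"
      using that assms by (intro div_nat_eqI) (auto simp: algebra_simps)
    with that show ?thesis
      using mult_div_mod_eq[of k i] by simp
  qed
  then show ?thesis
    using assms by (auto simp: residue_times_def)
qed

text \<open>Each period of length \<open>k\<close> contributes one index. For \<open>q = D\<close>,
  a walk through all layers updates each coordinate exactly \<open>D\<close> times, the number of
  summands in \<open>average_free\<close>.\<close>

lemma card_residue_times_multiple:
  assumes "j < k"
  shows "card (residue_times k 0 (k * q) j) = q"
proof (induction q)
  case (Suc q)
  then show ?case
    using card_residue_times_append[of 0 "k * q" "k * Suc q" k j] residue_times_period[OF assms, of q]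
    by simp
qed simp

text \<open>Any \<open>k\<close> consecutive integers meet every residue class. The witness lies in
  the period of \<open>s\<close> if the offset of \<open>s\<close> is at most \<open>j\<close>, and
  in the next period otherwise.\<close>

lemma residue_times_nonempty:
  assumes "j < k" "s + k \<le> t"
  shows "residue_times k s t j \<noteq> {}"
proof -
  define q where "q = s div k"
  have s: "s = k * q + s mod k" "s mod k < k"
    using assms by (auto simp: q_def)
  show ?thesis
  proof (cases "s mod k \<le> j")
    case True
    then have "k * q + j \<in> residue_times k s t j"
      using s assms by (auto simp: residue_times_def)
    then show ?thesis by auto
  next
    case False
    have "s \<le> k * Suc q + j" "k * Suc q + j < t"
      using False s assms unfolding mult_Suc_right by linarith+
    moreover have "(k * Suc q + j) mod k = j"
      using assms(1) by (subst mod_mult_self4) simp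
    ultimately have "k * Suc q + j \<in> residue_times k s t j"
      by (simp add: residue_times_def)
    then show ?thesis by auto
  qed
qed

section \<open>The layered graph and its size\<close>

locale round_robin =
  fixes k D M :: nat and V :: "nat set"
  assumes k_pos: "k > 0" and V_bound: "V \<subseteq> {..<M}" and V_nonempty: "V \<noteq> {}"
    and average_free: "average_free D V"
begin

text \<open>The final statement asks for vertices of type \<open>nat\<close>, so a layer and its
  coordinates are encoded by \<open>to_nat\<close>. Only the values of \<open>x\<close> below
  \<open>k\<close> enter; \<open>layer\<close> and \<open>coord\<close> decode.\<close>

definition node :: "nat \<Rightarrow> (nat \<Rightarrow> nat) \<Rightarrow> nat" where
  "node t x = to_nat (t, map x [0..<k])"

definition layer :: "nat \<Rightarrow> nat" where
  "layer z = fst (from_nat z :: nat \<times> nat list)"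

definition coord :: "nat \<Rightarrow> nat \<Rightarrow> nat" where
  "coord z j = snd (from_nat z :: nat \<times> nat list) ! j"

lemma layer_node [simp]: "layer (node t x) = t"
  by (simp add: layer_def node_def)

lemma coord_node [simp]: "j < k \<Longrightarrow> coord (node t x) j = x j"
  by (simp add: coord_def node_def)

lemma node_cong: "t = t' \<Longrightarrow> (\<And>j. j < k \<Longrightarrow> x j = y j) \<Longrightarrow> node t x = node t' y"
  by (simp add: node_def)

text \<open>The bound leaves room for a start below \<open>M\<close> followed by \<open>D\<close>
  increments below \<open>M\<close>, so critical paths never leave the graph.\<close>

definition states :: "(nat \<Rightarrow> nat) set" where
  "states = {x. \<forall>j<k. x j < (D + 1) * M}"

definition nodes :: "nat set" where
  "nodes = {node t x |t x. t \<le> k * D \<and> x \<in> states}"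

definition bump :: "nat \<Rightarrow> (nat \<Rightarrow> nat) \<Rightarrow> nat \<Rightarrow> nat \<Rightarrow> nat" where
  "bump t x w = x(t mod k := x (t mod k) + w)"

definition steps :: "(nat \<times> nat) set" where
  "steps = {(node t x, node (Suc t) (bump t x w)) |t x w.
     t < k * D \<and> w \<in> V \<and> x \<in> states \<and> bump t x w \<in> states}"

lemma finite_V: "finite V"
  using V_bound finite_subset by blast

lemma nodes_subset_lists:
  "nodes \<subseteq> to_nat ` ({..k * D} \<times> {xs. set xs \<subseteq> {..<(D + 1) * M} \<and> length xs = k})"
  by (auto simp: nodes_def node_def states_def intro!: imageI)

lemma finite_nodes: "finite nodes"
  by (rule finite_subset[OF nodes_subset_lists]) (auto intro: finite_lists_length_eq)

lemma card_nodes: "card nodes \<le> (k * D + 1) * ((D + 1) * M) ^ k"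
proof -
  let ?L = "{..k * D} \<times> {xs. set xs \<subseteq> {..<(D + 1) * M} \<and> length xs = k}"
  have "finite ?L"
    by (auto intro: finite_lists_length_eq)
  then have "card nodes \<le> card ?L"
    using card_mono[OF _ nodes_subset_lists] card_image_le le_trans by blast
  then show ?thesis
    by (simp add: card_cartesian_product card_lists_length_eq)
qed

text \<open>An arc is determined by its tail and the added element of \<open>V\<close>, because
  layer and coordinates can be decoded from the tail. This gives \<open>card_steps\<close>.\<close>

lemma steps_subset:
  "steps \<subseteq> (\<lambda>(z, w). (z, node (Suc (layer z)) (bump (layer z) (coord z) w))) ` (nodes \<times> V)"
proof
  fix e assume "e \<in> steps"
  then obtain t x w where e: "e = (node t x, node (Suc t) (bump t x w))"
    "t < k * D" "w \<in> V" "x \<in> states" by (auto simp: steps_def)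
  then have "node t x \<in> nodes"
    unfolding nodes_def by (blast intro: less_imp_le)
  \<comment> \<open>The function \<open>x\<close> and its decoded version are known to agree only
    below \<open>k\<close>.\<close>
  moreover have "node (Suc t) (bump t x w) = node (Suc t) (bump t (coord (node t x)) w)"
    using k_pos by (intro node_cong) (auto simp: bump_def)
  ultimately show "e \<in> (\<lambda>(z, w). (z, node (Suc (layer z)) (bump (layer z) (coord z) w))) ` (nodes \<times> V)"
    using e by (intro image_eqI[of _ _ "(node t x, w)"]) auto
qed

lemma finite_steps: "finite steps"
  by (rule finite_subset[OF steps_subset]) (simp add: finite_nodes finite_V)

lemma card_steps: "card steps \<le> card nodes * M"
proof -
  have "card steps \<le> card (nodes \<times> V)"
    using card_mono[OF _ steps_subset] card_image_le finite_nodes finite_V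
    by (meson finite_SigmaI finite_imageI le_trans)
  also have "\<dots> \<le> card nodes * M"
    using card_mono[OF _ V_bound] by (simp add: card_cartesian_product)
  finally show ?thesis .
qed

lemma steps_nodes: "steps \<subseteq> nodes \<times> nodes"
  by (auto simp: steps_def nodes_def; metis Suc_leI less_imp_le)

lemma layer_step: "(a, b) \<in> steps \<Longrightarrow> layer b = Suc (layer a)"
  by (auto simp: steps_def)

lemma coord_step:
  "(a, b) \<in> steps \<Longrightarrow>
    \<exists>w\<in>V. \<forall>j<k. coord b j = coord a j + (if layer a mod k = j then w else 0)"
  by (force simp: steps_def bump_def)

end

section \<open>Reachability and critical paths\<close>

text \<open>Vertices outside \<open>nodes\<close> are isolated and serve as padding.\<close>

locale round_robin_graph = round_robin +
  fixes G :: "nat pair_pre_digraph"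
  assumes arcs: "parcs G = steps" and nodes: "nodes \<subseteq> pverts G" and finite_verts: "finite (pverts G)"
begin

lemma pair_digraph: "pair_digraph G"
proof
  show "finite (pverts G)" by (rule finite_verts)
  show "finite (parcs G)" by (simp add: arcs finite_steps)
  show "fst e \<in> pverts G" "snd e \<in> pverts G" if "e \<in> parcs G" for e
    using that steps_nodes nodes unfolding arcs by fastforce+
  show "fst e \<noteq> snd e" if "e \<in> parcs G" for e
    using that layer_step[of "fst e" "snd e"] by (auto simp: arcs)
qed

text \<open>Each arc advances one layer, so a walk leaves every layer in between exactly once, and
  \<open>w\<close> can record the element added there. Reachability thereby becomes
  arithmetic.\<close>

lemma reachable_coord:
  assumes "a \<rightarrow>\<^sup>*\<^bsub>with_proj G\<^esub> b"
  obtains w where "range w \<subseteq> V" "layer a \<le> layer b"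
    "\<And>j. j < k \<Longrightarrow> coord b j = coord a j + sum w (residue_times k (layer a) (layer b) j)"
proof -
  have "\<exists>w. range w \<subseteq> V \<and> layer a \<le> layer b \<and>
      (\<forall>j<k. coord b j = coord a j + sum w (residue_times k (layer a) (layer b) j))"
    using assms unfolding reachable_def
  proof (induction rule: rtrancl_on_induct)
    case base
    \<comment> \<open>A default value, since \<open>w\<close> is total with range in
      \<open>V\<close>.\<close>
    obtain v where "v \<in> V" using V_nonempty by auto
    then show ?case by (intro exI[of _ "\<lambda>_. v"]) auto
  next
    case (step y z)
    then have yz: "(y, z) \<in> steps" by (simp add: arcs)
    obtain w where w: "range w \<subseteq> V" "layer a \<le> layer y"
      "\<And>j. j < k \<Longrightarrow> coord y j = coord a j + sum w (residue_times k (layer a) (layer y) j)"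
      using step by auto
    obtain v where v: "v \<in> V" "\<And>j. j < k \<Longrightarrow> coord z j = coord y j + (if layer y mod k = j then v else 0)"
      using coord_step[OF yz] by auto
    \<comment> \<open>The layer of \<open>y\<close> lies outside the earlier index sets, so
      overriding \<open>w\<close> there keeps the earlier sums.\<close>
    define w' where "w' = w(layer y := v)"
    have "sum w' (residue_times k (layer a) (layer y) j) = sum w (residue_times k (layer a) (layer y) j)" for j
      by (intro sum.cong) (auto simp: w'_def residue_times_def)
    moreover have "sum w' (residue_times k (layer y) (layer z) j) = (if layer y mod k = j then v else 0)" for j
      by (simp add: layer_step[OF yz] w'_def)
    ultimately have "coord z j = coord a j + sum w' (residue_times k (layer a) (layer z) j)" if "j < k" for j
      using that v(2) w(2,3) layer_step[OF yz]
        sum_residue_times_append[of "layer a" "layer y" "layer z" w' k j] by simp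
    moreover have "range w' \<subseteq> V"
      using w(1) v(1) by (auto simp: w'_def)
    ultimately show ?case
      using w(2) layer_step[OF yz] by (intro exI[of _ w']) auto
  qed
  then show ?thesis using that by blast
qed

text \<open>The coordinates, at layer \<open>t\<close>, of the critical path with start
  \<open>x\<close> and direction \<open>v\<close>.\<close>

definition line :: "(nat \<Rightarrow> nat) \<Rightarrow> (nat \<Rightarrow> nat) \<Rightarrow> nat \<Rightarrow> nat \<Rightarrow> nat" where
  "line x v t j = x j + card (residue_times k 0 t j) * v j"

definition pos :: "(nat \<Rightarrow> nat) \<Rightarrow> (nat \<Rightarrow> nat) \<Rightarrow> nat \<Rightarrow> nat" where
  "pos x v t = node t (line x v t)"

lemma line_states:
  assumes x: "x \<in> {..<k} \<rightarrow> {..<M}" and v: "v \<in> {..<k} \<rightarrow> V" and t: "t \<le> k * D"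
  shows "line x v t \<in> states"
proof -
  have "line x v t j < (D + 1) * M" if j: "j < k" for j
  proof -
    have "card (residue_times k 0 t j) \<le> D"
      using card_residue_times_append[of 0 t "k * D" k j] card_residue_times_multiple[OF j, of D] t by simp
    moreover have "v j \<le> M" "x j < M"
      using x v V_bound j by (auto dest: less_imp_le)
    ultimately have "line x v t j < M + D * M"
      unfolding line_def by (intro add_less_le_mono mult_le_mono)
    then show ?thesis by simp
  qed
  then show ?thesis by (simp add: states_def)
qed

lemma pos_step:
  assumes x: "x \<in> {..<k} \<rightarrow> {..<M}" and v: "v \<in> {..<k} \<rightarrow> V" and t: "t < k * D"
  shows "(pos x v t, pos x v (Suc t)) \<in> steps"
proof -
  have eq: "line x v (Suc t) = bump t (line x v t) (v (t mod k))"
    using card_residue_times_append[of 0 t "Suc t" k]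
    by (auto simp: line_def bump_def fun_eq_iff)
  have "v (t mod k) \<in> V"
    using v k_pos by auto
  then show ?thesis
    using t line_states[OF x v, of t] line_states[OF x v, of "Suc t"]
    unfolding steps_def pos_def eq by fastforce
qed

lemma pos_verts:
  assumes x: "x \<in> {..<k} \<rightarrow> {..<M}" and v: "v \<in> {..<k} \<rightarrow> V" and t: "t \<le> k * D"
  shows "pos x v t \<in> pverts G"
  using nodes line_states[OF assms] t unfolding nodes_def pos_def by blast

lemma pos_reachable:
  assumes x: "x \<in> {..<k} \<rightarrow> {..<M}" and v: "v \<in> {..<k} \<rightarrow> V" and t: "t \<le> k * D"
  shows "pos x v 0 \<rightarrow>\<^sup>*\<^bsub>with_proj G\<^esub> pos x v t"
  using t
proof (induction t)
  case 0
  then show ?case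
    using pos_verts[OF x v] by (simp add: reachable_def)
next
  case (Suc t)
  then show ?case
    using pos_step[OF x v, of t] pos_verts[OF x v, of "Suc t"] unfolding reachable_def
    by (auto simp: arcs intro: rtrancl_on_into_rtrancl_on)
qed

text \<open>This is where \<^const>\<open>average_free\<close> makes the critical path unique.\<close>

lemma between_coord:
  assumes v: "v \<in> {..<k} \<rightarrow> V"
    and from_start: "pos x v 0 \<rightarrow>\<^sup>*\<^bsub>with_proj G\<^esub> z"
    and to_end: "z \<rightarrow>\<^sup>*\<^bsub>with_proj G\<^esub> pos x v (k * D)"
    and j: "j < k"
  shows "coord z j = line x v (layer z) j"
proof -
  have line_0: "line x v 0 j = x j" if "j < k" for j
    by (simp add: line_def)
  have line_end: "line x v (k * D) j = x j + D * v j"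
    using card_residue_times_multiple[OF j, of D] by (simp add: line_def)
  obtain w1 where w1: "range w1 \<subseteq> V"
    "coord z j = x j + sum w1 (residue_times k 0 (layer z) j)"
    using reachable_coord[OF from_start] j unfolding pos_def layer_node coord_node[OF j] line_0[OF j]
    by (metis coord_node j line_0)
  obtain w2 where w2: "range w2 \<subseteq> V" "layer z \<le> k * D"
    "x j + D * v j = coord z j + sum w2 (residue_times k (layer z) (k * D) j)"
    using reachable_coord[OF to_end] j unfolding pos_def layer_node
    by (metis coord_node line_end)
  \<comment> \<open>Gluing the increments before and after \<open>z\<close> gives \<open>D\<close>
    elements of \<open>V\<close> with sum \<open>D * v j\<close>, so each of them is
    \<open>v j\<close>, in particular those before \<open>z\<close>.\<close>
  define w where "w i = (if i < layer z then w1 i else w2 i)" for i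
  have sum_w1: "sum w (residue_times k 0 (layer z) j) = sum w1 (residue_times k 0 (layer z) j)"
    by (intro sum.cong) (auto simp: w_def residue_times_def)
  have sum_w2: "sum w (residue_times k (layer z) (k * D) j) = sum w2 (residue_times k (layer z) (k * D) j)"
    by (intro sum.cong) (auto simp: w_def residue_times_def)
  have "sum w (residue_times k 0 (k * D) j) = D * v j"
    using sum_residue_times_append[of 0 "layer z" "k * D" w k j] sum_w1 sum_w2 w1 w2 by simp
  moreover have "w ` A \<subseteq> V" for A
    using w1(1) w2(1) by (auto simp: w_def)
  moreover have "v j \<in> V"
    using v j by auto
  ultimately have const: "w i = v j" if "i \<in> residue_times k 0 (k * D) j" for i
    using average_free[unfolded average_free_def, rule_format, of "residue_times k 0 (k * D) j" w "v j" i]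
      card_residue_times_multiple[OF j, of D] that by simp
  have "sum w (residue_times k 0 (layer z) j) = sum (\<lambda>_. v j) (residue_times k 0 (layer z) j)"
    using const residue_times_append(1)[of 0 "layer z" "k * D" k j] w2(2) by (intro sum.cong) auto
  then show ?thesis
    using w1(2) sum_w1 by (simp add: line_def)
qed

section \<open>Shortcuts along critical paths and the diameter bound\<close>

definition spans :: "nat \<times> nat \<Rightarrow> (nat \<Rightarrow> nat) \<times> (nat \<Rightarrow> nat) \<Rightarrow> bool" where
  "spans = (\<lambda>(a, b) (x, v). layer a + k \<le> layer b \<and>
     (\<forall>j<k. coord a j = line x v (layer a) j \<and> coord b j = line x v (layer b) j))"

text \<open>Two points determine a line: coordinate \<open>j\<close> grows by \<open>s * v j\<close>
  between the two ends, and \<open>s > 0\<close> because at least \<open>k\<close> layers are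
  crossed. This yields \<open>v j\<close>, and then \<open>x j\<close>.\<close>

lemma spans_unique:
  assumes "spans e (x, v)" "spans e (x', v')" and j: "j < k"
  shows "x j = x' j \<and> v j = v' j"
proof -
  obtain a b where e: "e = (a, b)" by (cases e)
  define r where "r = card (residue_times k 0 (layer a) j)"
  define s where "s = card (residue_times k (layer a) (layer b) j)"
  have layers: "layer a + k \<le> layer b"
    using assms by (simp add: e spans_def)
  then have "card (residue_times k 0 (layer b) j) = r + s"
    using card_residue_times_append[of 0 "layer a" "layer b" k j] by (simp add: r_def s_def)
  moreover have "line x v (layer a) j = line x' v' (layer a) j"
      "line x v (layer b) j = line x' v' (layer b) j"
    using assms by (auto simp: e spans_def)
  ultimately have eqs: "x j + r * v j = x' j + r * v' j" "x j + (r + s) * v j = x' j + (r + s) * v' j"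
    by (simp_all add: line_def flip: r_def)
  then have "s * v j = s * v' j"
    unfolding add_mult_distrib by linarith
  moreover have "s > 0"
    using residue_times_nonempty[OF j layers] by (simp add: s_def card_gt_0_iff)
  ultimately show ?thesis
    using eqs(1) by simp
qed

text \<open>Every vertex of the walk lies between the two ends of the critical path in
  \<open>G\<close>, hence on that path by \<open>between_coord\<close>. A shortcut in the walk would
  span the path if it advanced \<open>k\<close> layers, so each arc advances at most
  \<open>k\<close>. The start \<open>a\<close> is arbitrary to allow induction on the walk.\<close>

lemma unspanned_walk_length:
  assumes H: "shortcut_set G H"
    and x: "x \<in> {..<k} \<rightarrow> {..<M}" and v: "v \<in> {..<k} \<rightarrow> V"
    and unspanned: "\<And>e. e \<in> H \<Longrightarrow> \<not> spans e (x, v)"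
    and walk: "pre_digraph.awalk (with_proj (add_shortcuts G H)) a p (pos x v (k * D))"
    and a: "pos x v 0 \<rightarrow>\<^sup>*\<^bsub>with_proj G\<^esub> a"
  shows "k * D \<le> layer a + k * length p"
proof -
  interpret G: pair_digraph G by (rule pair_digraph)
  interpret GH: pair_digraph "add_shortcuts G H"
    by (rule pair_digraph_add_shortcuts[OF pair_digraph H])
  have arc: "c \<rightarrow>\<^sup>*\<^bsub>with_proj G\<^esub> d" if "(c, d) \<in> parcs (add_shortcuts G H)" for c d
    using that H by (auto simp: add_shortcuts_def shortcut_set_def)
  \<comment> \<open>Shortcuts join pairs already reachable in \<open>G\<close>, so adding them
    creates no new reachability.\<close>
  have reach: "c \<rightarrow>\<^sup>*\<^bsub>with_proj G\<^esub> d" if "GH.awalk c q d" for c q d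
    using that
  proof (induction q arbitrary: c)
    case Nil
    then have "c = d" "c \<in> pverts G"
      unfolding GH.awalk_Nil_iff by (auto simp: add_shortcuts_def)
    then show ?case
      by (simp add: reachable_def)
  next
    case (Cons e q)
    then show ?case
      using arc[of "fst e" "snd e"] by (auto simp: GH.awalk_Cons_iff intro: G.reachable_trans)
  qed
  show ?thesis
    using walk a
  proof (induction p arbitrary: a)
    case Nil
    then show ?case by (simp add: GH.awalk_Nil_iff pos_def)
  next
    case (Cons e p)
    obtain b where e: "e = (a, b)" and ab: "(a, b) \<in> parcs (add_shortcuts G H)"
      and p: "GH.awalk b p (pos x v (k * D))"
      using Cons.prems(1) by (cases e) (auto simp: GH.awalk_Cons_iff)
    have b: "pos x v 0 \<rightarrow>\<^sup>*\<^bsub>with_proj G\<^esub> b"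
      using Cons.prems(2) arc[OF ab] by (rule G.reachable_trans)
    have "layer b \<le> layer a + k"
    proof (cases "(a, b) \<in> H")
      case True
      have "a \<rightarrow>\<^sup>*\<^bsub>with_proj G\<^esub> pos x v (k * D)"
        using arc[OF ab] reach[OF p] by (rule G.reachable_trans)
      then have "\<forall>j<k. coord a j = line x v (layer a) j \<and> coord b j = line x v (layer b) j"
        using between_coord[OF v Cons.prems(2)] between_coord[OF v b reach[OF p]] by simp
      with unspanned[OF True] show ?thesis
        by (simp add: spans_def)
    next
      case False
      then have "layer b = Suc (layer a)"
        using ab layer_step by (simp add: add_shortcuts_def arcs)
      then show ?thesis using k_pos by simp
    qed
    with Cons.IH[OF p b] show ?case by simp
  qed
qed

text \<open>If every critical path had a spanning pair in \<open>H\<close>, choosing one for each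
  path would be injective by \<open>spans_unique\<close>, contradicting the count.\<close>

lemma exists_unspanned:
  assumes "finite H" "card H < (M * card V) ^ k"
  obtains x v where "x \<in> {..<k} \<rightarrow> {..<M}" "v \<in> {..<k} \<rightarrow> V" "\<And>e. e \<in> H \<Longrightarrow> \<not> spans e (x, v)"
proof -
  \<comment> \<open>With extensional functions, agreement below \<open>k\<close> is equality, so
    each path is counted once.\<close>
  define P where "P = ({..<k} \<rightarrow>\<^sub>E {..<M}) \<times> ({..<k} \<rightarrow>\<^sub>E V)"
  have card_P: "card P = (M * card V) ^ k"
    by (simp add: P_def card_cartesian_product card_funcsetE power_mult_distrib)
  have "\<exists>c\<in>P. \<forall>e\<in>H. \<not> spans e c"
  proof (rule ccontr)
    assume "\<not> ?thesis"
    then obtain h where h: "\<And>c. c \<in> P \<Longrightarrow> h c \<in> H" "\<And>c. c \<in> P \<Longrightarrow> spans (h c) c"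
      by metis
    have "inj_on h P"
    proof (rule inj_onI)
      fix c c' assume c: "c \<in> P" "c' \<in> P" "h c = h c'"
      have eq: "fst c j = fst c' j \<and> snd c j = snd c' j" if "j \<in> {..<k}" for j
        using spans_unique[of "h c" "fst c" "snd c" "fst c'" "snd c'" j] h(2)[OF c(1)] h(2)[OF c(2)] c(3) that
        by simp
      show "c = c'"
      proof (rule prod_eqI)
        show "fst c = fst c'"
          by (rule PiE_ext[where k = "{..<k}" and s = "\<lambda>_. {..<M}"]) (use c eq in \<open>simp_all add: P_def mem_Times_iff\<close>)
        show "snd c = snd c'"
          by (rule PiE_ext[where k = "{..<k}" and s = "\<lambda>_. V"]) (use c eq in \<open>simp_all add: P_def mem_Times_iff\<close>)
      qed
    qed
    then have "card P \<le> card H"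
      using h(1) assms(1) by (auto intro: card_inj_on_le)
    with card_P assms(2) show False by simp
  qed
  then obtain x v where "(x, v) \<in> P" "\<And>e. e \<in> H \<Longrightarrow> \<not> spans e (x, v)"
    by fastforce
  moreover have "x \<in> {..<k} \<rightarrow> {..<M}" "v \<in> {..<k} \<rightarrow> V"
    using \<open>(x, v) \<in> P\<close> by (auto simp: P_def)
  ultimately show ?thesis using that by blast
qed

lemma diameter_add_shortcuts:
  assumes H: "shortcut_set G H" and card_H: "card H < (M * card V) ^ k"
  shows "ereal (real D) \<le> digraph_diameter (with_proj (add_shortcuts G H))"
proof -
  interpret G: pair_digraph G by (rule pair_digraph)
  interpret GH: pair_digraph "add_shortcuts G H"
    by (rule pair_digraph_add_shortcuts[OF pair_digraph H])
  have "finite H"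
    using shortcut_set_subset[OF H] finite_verts by (meson finite_SigmaI finite_subset)
  then obtain x v where xv: "x \<in> {..<k} \<rightarrow> {..<M}" "v \<in> {..<k} \<rightarrow> V"
    and unspanned: "\<And>e. e \<in> H \<Longrightarrow> \<not> spans e (x, v)"
    using exists_unspanned card_H by metis
  let ?a = "pos x v 0" and ?b = "pos x v (k * D)"
  have a: "?a \<rightarrow>\<^sup>*\<^bsub>with_proj G\<^esub> ?a"
    using pos_reachable[OF xv, of 0] by simp
  have length: "D \<le> length p" if "GH.awalk ?a p ?b" for p
    using unspanned_walk_length[OF H xv unspanned that a] k_pos by (simp add: pos_def)
  then have dist: "ereal (real D) \<le> unweighted_dist (with_proj (add_shortcuts G H)) ?a ?b"
    unfolding GH.unweighted_dist_eq_INF_length by (intro INF_greatest) auto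
  \<comment> \<open>The diameter ranges over reachable pairs only, so reachability has to be carried
    over to the augmented graph.\<close>
  have "?a \<rightarrow>\<^sup>*\<^bsub>with_proj (add_shortcuts G H)\<^esub> ?b"
    using pos_reachable[OF xv, of "k * D"] unfolding reachable_def
    by (auto simp: add_shortcuts_def elim: rtrancl_on_mono[rotated -1])
  then have "unweighted_dist (with_proj (add_shortcuts G H)) ?a ?b
      \<le> digraph_diameter (with_proj (add_shortcuts G H))"
    unfolding digraph_diameter_def by (intro Max_ge GH.finite_unweighted_dists) auto
  with dist show ?thesis by (rule order_trans)
qed

end

section \<open>Padding and the choice of parameters\<close>

lemma sparse_graph_with_large_diameter:
  fixes k D M :: nat and V :: "nat set"
  assumes "k > 0" "V \<subseteq> {..<M}" "V \<noteq> {}" "average_free D V"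
  defines "n \<equiv> (k * D + 1) * ((D + 1) * M) ^ k * M"
  obtains G :: "nat pair_pre_digraph" where "pair_digraph G" "card (pverts G) = n" "card (parcs G) \<le> n"
    "\<And>H. shortcut_set G H \<Longrightarrow> card H < (M * card V) ^ k \<Longrightarrow>
      ereal (real D) \<le> digraph_diameter (with_proj (add_shortcuts G H))"
proof -
  interpret round_robin k D M V
    by unfold_locales fact+
  have "M > 0"
    using V_bound V_nonempty by (cases M) auto
  have "card nodes \<le> n"
    using order_trans[OF card_nodes, of n] \<open>M > 0\<close> by (simp add: n_def)
  \<comment> \<open>\<open>n\<close> is the bound on the number of arcs; fresh isolated vertices
    raise the vertex count to exactly \<open>n\<close>.\<close>
  obtain I where I: "finite I" "card I = n - card nodes" "I \<subseteq> UNIV - nodes"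
    using infinite_arbitrarily_large[of "UNIV - nodes" "n - card nodes"] finite_nodes by auto
  define W where "W = nodes \<union> I"
  have "card W = card nodes + card I"
    unfolding W_def using I finite_nodes by (intro card_Un_disjoint) auto
  then have W: "nodes \<subseteq> W" "finite W" "card W = n"
    using I finite_nodes \<open>card nodes \<le> n\<close> by (auto simp: W_def)
  interpret round_robin_graph k D M V "\<lparr>pverts = W, parcs = steps\<rparr>"
    using W by unfold_locales auto
  have "card steps \<le> n"
    unfolding n_def by (rule order_trans[OF card_steps mult_le_mono1[OF card_nodes]])
  then show ?thesis
    using that[OF pair_digraph] W diameter_add_shortcuts by simp
qed

text \<open>Taking \<open>k = N\<close> and Behrend's set in dimension \<open>N\<close> with entries
  below \<open>D ^ N\<close> makes every quantity a power of \<open>D\<close>, up to factors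
  depending on \<open>N\<close> alone. The condition on \<open>card H\<close> is the lower bound on
  the number of critical paths with its denominator cleared.\<close>

lemma polynomial_size_graph:
  fixes N D :: nat
  assumes N: "N > 0" and D: "D > 0"
  obtains n and G :: "nat pair_pre_digraph" where
    "D \<le> n" "n \<le> (N + 1) * 2 ^ N * D ^ ((N + 1) * (N\<^sup>2 + N + 1))"
    "pair_digraph G" "card (pverts G) = n" "card (parcs G) \<le> n"
    "\<And>H. shortcut_set G H \<Longrightarrow> card H * (N ^ N * D ^ (2 * N\<^sup>2)) < D ^ (N\<^sup>2 * (2 * N + 1)) \<Longrightarrow>
      ereal (real D) \<le> digraph_diameter (with_proj (add_shortcuts G H))"
proof -
  define M where "M = (D * D ^ N) ^ N"
  have M: "M = D ^ (N * (N + 1))" "M > 0"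
    using D by (simp_all add: M_def power_add algebra_simps flip: power_mult power_Suc)
  obtain V where V: "V \<subseteq> {..<M}" "average_free D V" "(D ^ N) ^ N \<le> card V * (N * (D ^ N)\<^sup>2)"
    using average_free_set[of N "D ^ N" D] N D unfolding M_def by auto
  have "V \<noteq> {}"
    using V(3) D by auto
  define n where "n = (N * D + 1) * ((D + 1) * M) ^ N * M"
  obtain G :: "nat pair_pre_digraph" where G: "pair_digraph G" "card (pverts G) = n" "card (parcs G) \<le> n"
    and diameter: "\<And>H. shortcut_set G H \<Longrightarrow> card H < (M * card V) ^ N \<Longrightarrow>
      ereal (real D) \<le> digraph_diameter (with_proj (add_shortcuts G H))"
    using sparse_graph_with_large_diameter[OF N V(1) \<open>V \<noteq> {}\<close> V(2)] unfolding n_def by blast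
  have "1 * D * 1 * 1 \<le> n"
    unfolding n_def using N M(2) by (intro mult_le_mono trans_le_add1) auto
  moreover have "n \<le> (N + 1) * 2 ^ N * D ^ ((N + 1) * (N\<^sup>2 + N + 1))"
  proof -
    \<comment> \<open>The estimates \<open>N * D + 1 \<le> (N + 1) * D\<close> and
      \<open>D + 1 \<le> 2 * D\<close> produce the constant factor.\<close>
    have "n \<le> ((N + 1) * D) * ((2 * D) * M) ^ N * M"
      unfolding n_def using D by (intro mult_le_mono power_mono) auto
    also have "\<dots> = (N + 1) * 2 ^ N * (D ^ (N + 1) * (D ^ (N * (N + 1))) ^ (N + 1))"
      by (simp add: M(1) power_mult_distrib algebra_simps)
    also have "D ^ (N + 1) * (D ^ (N * (N + 1))) ^ (N + 1) = D ^ ((N + 1) * (N\<^sup>2 + N + 1))"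
      unfolding power_mult[symmetric] power_add[symmetric]
      by (simp add: algebra_simps power2_eq_square)
    finally show ?thesis .
  qed
  moreover have "card H < (M * card V) ^ N"
    if "card H * (N ^ N * D ^ (2 * N\<^sup>2)) < D ^ (N\<^sup>2 * (2 * N + 1))" for H :: "nat rel"
  proof (rule ccontr)
    assume "\<not> ?thesis"
    then have le: "(M * card V) ^ N \<le> card H" by simp
    have "D ^ (N\<^sup>2 * (2 * N + 1)) = (M * (D ^ N) ^ N) ^ N"
      unfolding M(1) power_mult[symmetric] power_add[symmetric]
      by (simp add: algebra_simps power2_eq_square mult_2_right)
    also have "\<dots> \<le> (M * (card V * (N * (D ^ N)\<^sup>2))) ^ N"
      using V(3) by (intro power_mono mult_le_mono) auto
    also have "\<dots> = (M * card V) ^ N * (N ^ N * ((D ^ N)\<^sup>2) ^ N)"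
      by (simp add: power_mult_distrib)
    also have "((D ^ N)\<^sup>2) ^ N = D ^ (2 * N\<^sup>2)"
      unfolding power_mult[symmetric] by (simp add: algebra_simps power2_eq_square)
    also have "(M * card V) ^ N * (N ^ N * D ^ (2 * N\<^sup>2)) \<le> card H * (N ^ N * D ^ (2 * N\<^sup>2))"
      using le by (rule mult_le_mono1)
    finally show False using that by simp
  qed
  ultimately show ?thesis
    using that[of n G] G diameter by simp
qed

text \<open>With \<open>x = N\<close>, the graph has about \<open>D ^ ((N + 1) * (N\<^sup>2 + N + 1))\<close> vertices
  and \<open>D ^ (N\<^sup>2 * (2 * N + 1) - 2 * N\<^sup>2)\<close> critical paths.\<close>

lemma exponent_gap:
  fixes \<epsilon> x :: real
  assumes "x \<ge> 1" "\<epsilon> * x > 11" "\<epsilon> > 0"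
  shows "(x + 1) * (x\<^sup>2 + x + 1) * (2 - \<epsilon>) + 2 * x\<^sup>2 < x\<^sup>2 * (2 * x + 1)"
proof -
  \<comment> \<open>After expansion the cubic terms without \<open>\<epsilon>\<close> cancel, and
    \<open>5 * x\<^sup>2 + 4 * x + 2\<close> must be beaten by a term of size at least
    \<open>\<epsilon> * x ^ 3\<close>; the constant is 11 = 5 + 4 + 2.\<close>
  have "5 * x\<^sup>2 + 4 * x + 2 \<le> 11 * x\<^sup>2"
    using assms(1) self_le_power[of x 2] by simp
  also have "\<dots> < (\<epsilon> * x) * x\<^sup>2"
    using assms by (intro mult_strict_right_mono) auto
  also have "\<dots> \<le> (\<epsilon> * x) * x\<^sup>2 + \<epsilon> * (2 * x\<^sup>2 + 2 * x + 1)"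
    using assms by simp
  also have "\<dots> = x\<^sup>2 * (2 * x + 1) - ((x + 1) * (x\<^sup>2 + x + 1) * (2 - \<epsilon>) + 2 * x\<^sup>2)
      + (5 * x\<^sup>2 + 4 * x + 2)"
    by (simp add: algebra_simps power2_eq_square)
  finally show ?thesis
    by simp
qed

section \<open>Growth estimates with real exponents\<close>

text \<open>Solving the size bound for \<open>D\<close> turns the diameter bound \<open>D\<close>
  into a power of \<open>n\<close>.\<close>

lemma powr_root_le:
  fixes n \<kappa> D :: real
  assumes "0 \<le> n" "n \<le> \<kappa> * D ^ A" "\<kappa> > 0" "D > 0" "A > 0"
  shows "\<kappa> powr (- 1 / A) * n powr (1 / A) \<le> D"
proof -
  have "n powr (1 / A) \<le> (\<kappa> * D ^ A) powr (1 / A)"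
    using assms by (intro powr_mono2) auto
  also have "\<dots> = \<kappa> powr (1 / A) * D"
    using assms by (simp add: powr_mult powr_powr flip: powr_realpow)
  finally have "\<kappa> powr (- 1 / A) * n powr (1 / A) \<le> \<kappa> powr (- 1 / A) * (\<kappa> powr (1 / A) * D)"
    by (intro mult_left_mono) auto
  also have "\<dots> = D"
    using assms by (simp add: powr_minus field_simps)
  finally show ?thesis .
qed

text \<open>Inserting the bound on \<open>n\<close> leaves a constant \<open>L\<close> times a power
  of \<open>D\<close> whose exponent falls short of \<open>q\<close> by \<open>\<eta> > 0\<close>.
  The threshold makes \<open>D powr \<eta>\<close> exceed \<open>L\<close>, uniformly in
  \<open>n\<close>.\<close>

lemma eventually_power_dominates:
  fixes C \<kappa> s :: real and A p q b :: nat
  assumes pos: "C > 0" "\<kappa> > 0" "s \<ge> 0" and gap: "A * s + p < q"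
  obtains D0 :: nat where "\<And>(D :: nat) n. D \<ge> D0 \<Longrightarrow> D > 0 \<Longrightarrow> 0 \<le> n \<Longrightarrow> n \<le> \<kappa> * real D ^ A \<Longrightarrow>
    C * n powr s * (real b * real D ^ p) < real D ^ q"
proof -
  define \<eta> where "\<eta> = q - (A * s + p)"
  define L where "L = C * \<kappa> powr s * real b"
  have \<eta>: "\<eta> > 0" using gap by (simp add: \<eta>_def)
  have L: "L \<ge> 0" using pos by (simp add: L_def)
  obtain D0 :: nat where D0: "L powr (1 / \<eta>) < D0"
    using reals_Archimedean2 by blast
  have "C * n powr s * (real b * real D ^ p) < real D ^ q"
    if D: "D \<ge> D0" "D > 0" and n: "0 \<le> n" "n \<le> \<kappa> * real D ^ A" for D :: nat and n :: real
  proof -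
    have "L = (L powr (1 / \<eta>)) powr \<eta>"
      using L \<eta> by (simp add: powr_powr)
    also have "\<dots> < real D powr \<eta>"
      using D0 D \<eta> by (intro powr_less_mono2) auto
    finally have L_less: "L < real D powr \<eta>" .
    have "n powr s \<le> (\<kappa> * real D ^ A) powr s"
      using n pos by (intro powr_mono2) auto
    also have "\<dots> = \<kappa> powr s * real D powr (A * s)"
      using D pos by (simp add: powr_mult powr_powr flip: powr_realpow)
    finally have "C * n powr s * (real b * real D ^ p) \<le> C * (\<kappa> powr s * real D powr (A * s)) * (real b * real D ^ p)"
      using pos by (intro mult_right_mono mult_left_mono) auto
    also have "\<dots> = L * real D powr (A * s + p)"
      using D by (simp add: L_def powr_add powr_realpow)
    also have "\<dots> < real D powr \<eta> * real D powr (A * s + p)"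
      using D L_less by (intro mult_strict_right_mono) auto
    also have "\<dots> = real D ^ q"
      using D by (simp add: \<eta>_def powr_realpow flip: powr_add)
    finally show ?thesis .
  qed
  then show ?thesis using that by blast
qed

section \<open>Choice of the exponent and constants for a given \<open>\<epsilon>\<close>\<close>

theorem theorem5p3:
  shows "\<forall>\<epsilon>::real. \<epsilon> > 0 \<longrightarrow>
    (\<exists>(\<delta>::real) (K::real). \<delta> > 0 \<and> K > 0 \<and>
      (\<forall>C::real. C > 0 \<longrightarrow>
        (\<exists>c::real. c > 0 \<and>
          infinite {n::nat. n > 0 \<and>
            (\<exists>G :: nat pair_pre_digraph.
              pair_digraph G \<and> card (pverts G) = n \<and>
              real (card (parcs G)) \<le> K * real n \<and>
              (\<forall>H. shortcut_set G H \<and> real (card H) \<le> C * real n powr (2 - \<epsilon>) \<longrightarrow>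
                digraph_diameter (with_proj (add_shortcuts G H))
                  \<ge> ereal (c * real n powr \<delta>)))})))"
proof (intro allI impI)
  fix \<epsilon> :: real assume \<epsilon>: "\<epsilon> > 0"
  \<comment> \<open>Capping at 1 keeps the exponent \<open>2 - \<epsilon>'\<close> nonnegative, so
    that \<open>n powr (2 - \<epsilon>')\<close> is monotone in \<open>n\<close>; it only enlarges
    the allowed number of shortcuts.\<close>
  define \<epsilon>' where "\<epsilon>' = min \<epsilon> 1"
  have \<epsilon>': "\<epsilon>' > 0" "\<epsilon>' \<le> 1" "\<epsilon>' \<le> \<epsilon>"
    using \<epsilon> by (auto simp: \<epsilon>'_def)
  obtain N :: nat where "11 / \<epsilon>' < N"
    using reals_Archimedean2 by blast
  then have N_eps: "\<epsilon>' * N > 11"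
    using \<epsilon>' by (simp add: field_simps)
  then have N: "N > 0"
    by (cases N) auto
  define A where "A = (N + 1) * (N\<^sup>2 + N + 1)"
  define \<kappa> where "\<kappa> = real ((N + 1) * 2 ^ N)"
  have A: "A > 0" and \<kappa>: "\<kappa> > 0"
    unfolding A_def \<kappa>_def of_nat_0_less_iff by simp_all
  have exponent_nonneg: "2 - \<epsilon>' \<ge> 0"
    using \<epsilon>' by simp
  have gap: "A * (2 - \<epsilon>') + real (2 * N\<^sup>2) < real (N\<^sup>2 * (2 * N + 1))"
    using exponent_gap[of "real N" \<epsilon>'] N N_eps \<epsilon>' by (simp add: A_def algebra_simps)
  show "\<exists>(\<delta>::real) (K::real). \<delta> > 0 \<and> K > 0 \<and>
      (\<forall>C::real. C > 0 \<longrightarrow>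
        (\<exists>c::real. c > 0 \<and>
          infinite {n::nat. n > 0 \<and>
            (\<exists>G :: nat pair_pre_digraph.
              pair_digraph G \<and> card (pverts G) = n \<and>
              real (card (parcs G)) \<le> K * real n \<and>
              (\<forall>H. shortcut_set G H \<and> real (card H) \<le> C * real n powr (2 - \<epsilon>) \<longrightarrow>
                digraph_diameter (with_proj (add_shortcuts G H))
                  \<ge> ereal (c * real n powr \<delta>)))}))"
  \<comment> \<open>Both values depend on \<open>\<epsilon>\<close> alone; \<open>C\<close> enters
    only through the threshold \<open>D0\<close>.\<close>
  proof (rule exI[of _ "1 / A"], rule exI[of _ 1], intro conjI allI impI)
    fix C :: real assume C: "C > 0"
    obtain D0 :: nat where dominates: "\<And>(D :: nat) n. D \<ge> D0 \<Longrightarrow> D > 0 \<Longrightarrow> 0 \<le> n \<Longrightarrow>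
        n \<le> \<kappa> * real D ^ A \<Longrightarrow>
        C * n powr (2 - \<epsilon>') * (real (N ^ N) * real D ^ (2 * N\<^sup>2)) < real D ^ (N\<^sup>2 * (2 * N + 1))"
      using eventually_power_dominates[OF C \<kappa> exponent_nonneg gap, where b = "N ^ N"] by blast
    show "\<exists>c::real. c > 0 \<and>
          infinite {n::nat. n > 0 \<and>
            (\<exists>G :: nat pair_pre_digraph.
              pair_digraph G \<and> card (pverts G) = n \<and>
              real (card (parcs G)) \<le> 1 * real n \<and>
              (\<forall>H. shortcut_set G H \<and> real (card H) \<le> C * real n powr (2 - \<epsilon>) \<longrightarrow>
                digraph_diameter (with_proj (add_shortcuts G H))
                  \<ge> ereal (c * real n powr (1 / A))))}"
      unfolding infinite_nat_iff_unbounded_le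
    proof (rule exI[of _ "\<kappa> powr (- 1 / A)"], intro conjI allI)
      fix m :: nat
      \<comment> \<open>Exceeding \<open>m\<close> forces \<open>n \<ge> m\<close>, which makes the
        set of sizes unbounded.\<close>
      define D where "D = Suc (max m D0)"
      have D: "D > 0" "D \<ge> D0" "m \<le> D"
        by (auto simp: D_def)
      obtain n and G :: "nat pair_pre_digraph" where n: "D \<le> n"
          "n \<le> (N + 1) * 2 ^ N * D ^ ((N + 1) * (N\<^sup>2 + N + 1))"
        and G: "pair_digraph G" "card (pverts G) = n" "card (parcs G) \<le> n"
        and diameter: "\<And>H. shortcut_set G H \<Longrightarrow>
          card H * (N ^ N * D ^ (2 * N\<^sup>2)) < D ^ (N\<^sup>2 * (2 * N + 1)) \<Longrightarrow>
          ereal (real D) \<le> digraph_diameter (with_proj (add_shortcuts G H))"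
        using polynomial_size_graph[OF N D(1)] by blast
      have n_le: "real n \<le> \<kappa> * real D ^ A"
        using n(2) unfolding A_def \<kappa>_def by (metis of_nat_le_iff of_nat_mult of_nat_power)
      have "ereal (\<kappa> powr (- 1 / A) * real n powr (1 / A))
          \<le> digraph_diameter (with_proj (add_shortcuts G H))"
        if H: "shortcut_set G H" "real (card H) \<le> C * real n powr (2 - \<epsilon>)" for H
      proof -
        have "real n powr (2 - \<epsilon>) \<le> real n powr (2 - \<epsilon>')"
          using \<epsilon>'(3) n(1) D(1) by (intro powr_mono) auto
        then have "real (card H) \<le> C * real n powr (2 - \<epsilon>')"
          using order_trans[OF H(2) mult_left_mono] C by simp
        then have "real (card H) * (real (N ^ N) * real D ^ (2 * N\<^sup>2))
            \<le> C * real n powr (2 - \<epsilon>') * (real (N ^ N) * real D ^ (2 * N\<^sup>2))"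
          by (intro mult_right_mono) auto
        also have "\<dots> < real D ^ (N\<^sup>2 * (2 * N + 1))"
          using dominates[OF D(2,1) _ n_le] by simp
        finally have "card H * (N ^ N * D ^ (2 * N\<^sup>2)) < D ^ (N\<^sup>2 * (2 * N + 1))"
          by (metis of_nat_less_iff of_nat_mult of_nat_power)
        then have "ereal (real D) \<le> digraph_diameter (with_proj (add_shortcuts G H))"
          using diameter H(1) by simp
        moreover have "ereal (\<kappa> powr (- 1 / A) * real n powr (1 / A)) \<le> ereal (real D)"
          using powr_root_le[OF _ n_le \<kappa> _ A] D(1) by simp
        ultimately show ?thesis by (rule order_trans[rotated])
      qed
      then show "\<exists>n\<ge>m. n \<in> {n::nat. n > 0 \<and>
            (\<exists>G :: nat pair_pre_digraph.
              pair_digraph G \<and> card (pverts G) = n \<and>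
              real (card (parcs G)) \<le> 1 * real n \<and>
              (\<forall>H. shortcut_set G H \<and> real (card H) \<le> C * real n powr (2 - \<epsilon>) \<longrightarrow>
                digraph_diameter (with_proj (add_shortcuts G H))
                  \<ge> ereal (\<kappa> powr (- 1 / A) * real n powr (1 / A))))}"
        using n(1) D G by (intro exI[of _ n]) auto
    qed (use \<kappa> in simp)
  qed (use A in auto)
qed

end
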